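(* If a program $\mathsf{P}$ of the language $\mathcal{H}$ is stratified, then it is locally stratified.
   Context: Types of $\mathcal{H}$: base types $\iota,o$; functional types $\sigma::=\iota\mid\iota\to\sigma$; predicate types $\pi::=o\mid\rho\to\pi$; argument types $\rho::=\iota\mid\pi$ ($\to$ right-associative). Terms are built from predicate variables/constants (of predicate types), individual variables/constants (type $\iota$) and function symbols (types $\iota^n\to\iota$) by typed application; expressions also include $(\sim\mathsf{E})$ for a term $\mathsf{E}:o$ and $(\mathsf{E}_1\approx\mathsf{E}_2)$ for terms of type $\iota$. Atoms are terms of type $o$. A clause is $\mathsf{p}\,\mathsf{V}_1\cdots\mathsf{V}_n\leftarrow\mathsf{L}_1,\dots,\mathsf{L}_m$ with $\mathsf{p}$ a predicate constant of type $\rho_1\to\cdots\to\rho_n\to o$, $\mathsf{V}_i$ distinct variables of type $\rho_i$, and each $\mathsf{L}_j$ an atom, an $\approx$-expression or the negation $(\sim\mathsf{B})$ of an atom; a program is a finite set of clauses. $U_{\mathsf{P},\rho}$ is the set of ground terms of type $\rho$ built from the symbols of $\mathsf{P}$. $\mathsf{Gr(P)}$ is the set of all instances of clauses of $\mathsf{P}$ obtained by substituting for every variable of the clause an element of $U_{\mathsf{P},\rho}$ of its type. Locally stratified: $U_{\mathsf{P},o}$ can be partitioned into disjoint sets $S_\alpha$, $\alpha<\gamma$ for a countable ordinal $\gamma$, such that for every clause $\mathsf{H}\leftarrow\mathsf{A}_1,\dots,\mathsf{A}_m,\sim\mathsf{B}_1,\dots,\sim\mathsf{B}_n$ of $\mathsf{Gr(P)}$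 (with positive literals $\mathsf{A}_i$), $\mathit{stratum}(\mathsf{A}_i)\le\mathit{stratum}(\mathsf{H})$ and $\mathit{stratum}(\mathsf{B}_j)<\mathit{stratum}(\mathsf{H})$, where $\mathit{stratum}(\mathsf{C})=\beta$ if $\mathsf{C}\in S_\beta$ and $\mathit{stratum}(\mathsf{C})=0$ for $\mathsf{C}$ of the form $(\mathsf{E}_1\approx\mathsf{E}_2)$. Stratified: a predicate type $\pi$ is greater than a predicate type $\pi'$ if $\pi=\rho_1\to\cdots\to\rho_n\to\pi'$ with $n\ge1$. $\mathsf{P}$ is stratified iff the set of predicate constants appearing in $\mathsf{P}$ can be partitioned into finitely many disjoint sets $S_1,\dots,S_r$ (with $\mathit{stratum}(\mathsf{r})=i$ iff $\mathsf{r}\in S_i$) such that for every clause $\mathsf{H}\leftarrow\mathsf{A}_1,\dots,\mathsf{A}_m,\sim\mathsf{B}_1,\dots,\sim\mathsf{B}_n$ of $\mathsf{P}$ whose head has predicate constant $\mathsf{p}$: (1) if $\mathsf{A}_i$ is a term starting with a predicate constant $\mathsf{q}$ then $\mathit{stratum}(\mathsf{q})\le\mathit{stratum}(\mathsf{p})$; (2) if $\mathsf{A}_i$ is a term starting with a predicate variable $\mathsf{Q}$, then every predicate constant $\mathsf{q}$ of $\mathsf{P}$ whose type is greater than or equal to the type of $\mathsf{Q}$ satisfies $\mathit{stratum}(\mathsf{q})\le\mathit{stratum}(\mathsf{p})$; (3) if $\mathsf{B}_i$ starts with a predicate constant $\mathsf{q}$ then $\mathit{stratum}(\mathsf{q})<\mathit{stratum}(\mathsf{p})$;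 (4) if $\mathsf{B}_i$ starts with a predicate variable $\mathsf{Q}$, then every predicate constant $\mathsf{q}$ of $\mathsf{P}$ whose type is greater than or equal to the type of $\mathsf{Q}$ satisfies $\mathit{stratum}(\mathsf{q})<\mathit{stratum}(\mathsf{p})$. *)

theory Defs
  imports Main "HOL-Library.Disjoint_Sets"
begin

text \<open>Argument types \<open>\<rho> ::= \<iota> | \<pi>\<close> and predicate types \<open>\<pi> ::= o | \<rho> \<rightarrow> \<pi>\<close>. The functional
  type \<open>\<iota>\<^sup>n \<rightarrow> \<iota>\<close> is represented by its arity \<open>n\<close>.\<close>

datatype argty = Iota | Pred predty
and predty = Omicron | Arr argty predty

text \<open>A symbol is a name together with its type, so that names may be shared between types.
  \<open>Var x Iota\<close> is an individual variable, \<open>Var x (Pred \<pi>)\<close> a predicate variable.\<close>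

datatype ('v, 'p, 'c, 'f) tm =
    Var 'v argty
  | PConst 'p predty
  | IConst 'c
  | FunApp 'f nat "('v, 'p, 'c, 'f) tm list"
  | App "('v, 'p, 'c, 'f) tm" "('v, 'p, 'c, 'f) tm"

inductive has_type :: "('v, 'p, 'c, 'f) tm \<Rightarrow> argty \<Rightarrow> bool" where
  "has_type (Var x \<rho>) \<rho>"
| "has_type (PConst p \<pi>) (Pred \<pi>)"
| "has_type (IConst c) Iota"
| "\<lbrakk>0 < n; length ts = n; \<forall>t\<in>set ts. has_type t Iota\<rbrakk> \<Longrightarrow> has_type (FunApp f n ts) Iota"
| "\<lbrakk>has_type s (Pred (Arr \<rho> \<pi>)); has_type t \<rho>\<rbrakk> \<Longrightarrow> has_type (App s t) (Pred \<pi>)"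

definition is_atom :: "('v, 'p, 'c, 'f) tm \<Rightarrow> bool" where
  "is_atom t \<longleftrightarrow> has_type t (Pred Omicron)"

datatype ('v, 'p, 'c, 'f) literal =
    PosLit "('v, 'p, 'c, 'f) tm"
  | EqLit "('v, 'p, 'c, 'f) tm" "('v, 'p, 'c, 'f) tm"
  | NegLit "('v, 'p, 'c, 'f) tm"

fun wf_literal :: "('v, 'p, 'c, 'f) literal \<Rightarrow> bool" where
  "wf_literal (PosLit A) \<longleftrightarrow> is_atom A"
| "wf_literal (EqLit s t) \<longleftrightarrow> has_type s Iota \<and> has_type t Iota"
| "wf_literal (NegLit B) \<longleftrightarrow> is_atom B"

type_synonym ('v, 'p, 'c, 'f) clause = "('v, 'p, 'c, 'f) tm \<times> ('v, 'p, 'c, 'f) literal list"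

definition is_head :: "('v, 'p, 'c, 'f) tm \<Rightarrow> bool" where
  "is_head H \<longleftrightarrow> is_atom H \<and>
     (\<exists>p \<pi> Vs. distinct Vs \<and> H = foldl App (PConst p \<pi>) (map (\<lambda>(x, \<rho>). Var x \<rho>) Vs))"

definition is_clause :: "('v, 'p, 'c, 'f) clause \<Rightarrow> bool" where
  "is_clause C \<longleftrightarrow> is_head (fst C) \<and> (\<forall>L\<in>set (snd C). wf_literal L)"

definition is_program :: "('v, 'p, 'c, 'f) clause set \<Rightarrow> bool" where
  "is_program P \<longleftrightarrow> finite P \<and> (\<forall>C\<in>P. is_clause C)"

fun tm_vars :: "('v, 'p, 'c, 'f) tm \<Rightarrow> ('v \<times> argty) set" where
  "tm_vars (Var x \<rho>) = {(x, \<rho>)}"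
| "tm_vars (PConst p \<pi>) = {}"
| "tm_vars (IConst c) = {}"
| "tm_vars (FunApp f n ts) = (\<Union>t\<in>set ts. tm_vars t)"
| "tm_vars (App s t) = tm_vars s \<union> tm_vars t"

fun tm_preds :: "('v, 'p, 'c, 'f) tm \<Rightarrow> ('p \<times> predty) set" where
  "tm_preds (Var x \<rho>) = {}"
| "tm_preds (PConst p \<pi>) = {(p, \<pi>)}"
| "tm_preds (IConst c) = {}"
| "tm_preds (FunApp f n ts) = (\<Union>t\<in>set ts. tm_preds t)"
| "tm_preds (App s t) = tm_preds s \<union> tm_preds t"

fun tm_iconsts :: "('v, 'p, 'c, 'f) tm \<Rightarrow> 'c set" where
  "tm_iconsts (Var x \<rho>) = {}"
| "tm_iconsts (PConst p \<pi>) = {}"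
| "tm_iconsts (IConst c) = {c}"
| "tm_iconsts (FunApp f n ts) = (\<Union>t\<in>set ts. tm_iconsts t)"
| "tm_iconsts (App s t) = tm_iconsts s \<union> tm_iconsts t"

fun tm_funs :: "('v, 'p, 'c, 'f) tm \<Rightarrow> ('f \<times> nat) set" where
  "tm_funs (Var x \<rho>) = {}"
| "tm_funs (PConst p \<pi>) = {}"
| "tm_funs (IConst c) = {}"
| "tm_funs (FunApp f n ts) = {(f, n)} \<union> (\<Union>t\<in>set ts. tm_funs t)"
| "tm_funs (App s t) = tm_funs s \<union> tm_funs t"

fun literal_tms :: "('v, 'p, 'c, 'f) literal \<Rightarrow> ('v, 'p, 'c, 'f) tm set" where
  "literal_tms (PosLit A) = {A}"
| "literal_tms (EqLit s t) = {s, t}"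
| "literal_tms (NegLit B) = {B}"

definition clause_tms :: "('v, 'p, 'c, 'f) clause \<Rightarrow> ('v, 'p, 'c, 'f) tm set" where
  "clause_tms C = {fst C} \<union> (\<Union>L\<in>set (snd C). literal_tms L)"

definition clause_vars :: "('v, 'p, 'c, 'f) clause \<Rightarrow> ('v \<times> argty) set" where
  "clause_vars C = (\<Union>t\<in>clause_tms C. tm_vars t)"

definition prog_preds :: "('v, 'p, 'c, 'f) clause set \<Rightarrow> ('p \<times> predty) set" where
  "prog_preds P = (\<Union>C\<in>P. \<Union>t\<in>clause_tms C. tm_preds t)"

definition prog_iconsts :: "('v, 'p, 'c, 'f) clause set \<Rightarrow> 'c set" where
  "prog_iconsts P = (\<Union>C\<in>P. \<Union>t\<in>clause_tms C. tm_iconsts t)"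

definition prog_funs :: "('v, 'p, 'c, 'f) clause set \<Rightarrow> ('f \<times> nat) set" where
  "prog_funs P = (\<Union>C\<in>P. \<Union>t\<in>clause_tms C. tm_funs t)"

definition herbrand :: "('v, 'p, 'c, 'f) clause set \<Rightarrow> argty \<Rightarrow> ('v, 'p, 'c, 'f) tm set" where
  "herbrand P \<rho> = {t. has_type t \<rho> \<and> tm_vars t = {} \<and> tm_preds t \<subseteq> prog_preds P \<and>
     tm_iconsts t \<subseteq> prog_iconsts P \<and> tm_funs t \<subseteq> prog_funs P}"

fun tm_subst ::
  "('v \<times> argty \<Rightarrow> ('v, 'p, 'c, 'f) tm) \<Rightarrow> ('v, 'p, 'c, 'f) tm \<Rightarrow> ('v, 'p, 'c, 'f) tm" where
  "tm_subst \<theta> (Var x \<rho>) = \<theta> (x, \<rho>)"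
| "tm_subst \<theta> (PConst p \<pi>) = PConst p \<pi>"
| "tm_subst \<theta> (IConst c) = IConst c"
| "tm_subst \<theta> (FunApp f n ts) = FunApp f n (map (tm_subst \<theta>) ts)"
| "tm_subst \<theta> (App s t) = App (tm_subst \<theta> s) (tm_subst \<theta> t)"

fun literal_subst ::
  "('v \<times> argty \<Rightarrow> ('v, 'p, 'c, 'f) tm) \<Rightarrow> ('v, 'p, 'c, 'f) literal \<Rightarrow> ('v, 'p, 'c, 'f) literal" where
  "literal_subst \<theta> (PosLit A) = PosLit (tm_subst \<theta> A)"
| "literal_subst \<theta> (EqLit s t) = EqLit (tm_subst \<theta> s) (tm_subst \<theta> t)"
| "literal_subst \<theta> (NegLit B) = NegLit (tm_subst \<theta> B)"

definition clause_subst ::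
  "('v \<times> argty \<Rightarrow> ('v, 'p, 'c, 'f) tm) \<Rightarrow> ('v, 'p, 'c, 'f) clause \<Rightarrow> ('v, 'p, 'c, 'f) clause" where
  "clause_subst \<theta> C = (tm_subst \<theta> (fst C), map (literal_subst \<theta>) (snd C))"

definition Gr :: "('v, 'p, 'c, 'f) clause set \<Rightarrow> ('v, 'p, 'c, 'f) clause set" where
  "Gr P = {clause_subst \<theta> C |\<theta> C.
     C \<in> P \<and> (\<forall>(x, \<rho>)\<in>clause_vars C. \<theta> (x, \<rho>) \<in> herbrand P \<rho>)}"

text \<open>A countable ordinal \<open>\<gamma>\<close> is represented by a well-order on a set of natural numbers, with
  \<open>\<alpha> < \<gamma>\<close> becoming \<open>\<alpha> \<in> Field \<gamma>\<close>; every countable ordinal, finite ones included, is the order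
  type of such a well-order. The ordinal \<open>0\<close> is then the least element of the field.\<close>

definition atom_stratum ::
  "nat rel \<Rightarrow> (nat \<Rightarrow> ('v, 'p, 'c, 'f) tm set) \<Rightarrow> ('v, 'p, 'c, 'f) tm \<Rightarrow> nat" where
  "atom_stratum \<gamma> S A = (THE \<beta>. \<beta> \<in> Field \<gamma> \<and> A \<in> S \<beta>)"

definition zero_stratum :: "nat rel \<Rightarrow> nat" where
  "zero_stratum \<gamma> = wo_rel.minim \<gamma> (Field \<gamma>)"

fun literal_locally_ok ::
  "nat rel \<Rightarrow> (nat \<Rightarrow> ('v, 'p, 'c, 'f) tm set) \<Rightarrow> ('v, 'p, 'c, 'f) tm \<Rightarrow>
   ('v, 'p, 'c, 'f) literal \<Rightarrow> bool" where
  "literal_locally_ok \<gamma> S H (PosLit A) \<longleftrightarrow> (atom_stratum \<gamma> S A, atom_stratum \<gamma> S H) \<in> \<gamma>"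
| "literal_locally_ok \<gamma> S H (EqLit s t) \<longleftrightarrow> (zero_stratum \<gamma>, atom_stratum \<gamma> S H) \<in> \<gamma>"
| "literal_locally_ok \<gamma> S H (NegLit B) \<longleftrightarrow> (atom_stratum \<gamma> S B, atom_stratum \<gamma> S H) \<in> \<gamma> - Id"

definition locally_stratified :: "('v, 'p, 'c, 'f) clause set \<Rightarrow> bool" where
  "locally_stratified P \<longleftrightarrow>
     (\<exists>(\<gamma> :: nat rel) S. Well_order \<gamma> \<and>
        (\<Union>\<alpha>\<in>Field \<gamma>. S \<alpha>) = herbrand P (Pred Omicron) \<and>
        disjoint_family_on S (Field \<gamma>) \<and>
        (\<forall>(H, Ls)\<in>Gr P. \<forall>L\<in>set Ls. literal_locally_ok \<gamma> S H L))"

definition predty_greater :: "predty \<Rightarrow> predty \<Rightarrow> bool" where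
  "predty_greater \<pi> \<pi>' \<longleftrightarrow> (\<exists>\<rho>s. \<rho>s \<noteq> [] \<and> \<pi> = foldr Arr \<rho>s \<pi>')"

text \<open>A term starts with the predicate constant or variable at the head of its application
  spine.\<close>

fun spine_head :: "('v, 'p, 'c, 'f) tm \<Rightarrow> ('v, 'p, 'c, 'f) tm" where
  "spine_head (App s t) = spine_head s"
| "spine_head t = t"

definition pred_stratum :: "nat \<Rightarrow> (nat \<Rightarrow> ('p \<times> predty) set) \<Rightarrow> 'p \<times> predty \<Rightarrow> nat" where
  "pred_stratum r S q = (THE i. i \<in> {1..r} \<and> q \<in> S i)"

definition preds_ge :: "('v, 'p, 'c, 'f) clause set \<Rightarrow> predty \<Rightarrow> ('p \<times> predty) set" where
  "preds_ge P \<pi> = {(q, \<pi>') \<in> prog_preds P. predty_greater \<pi>' \<pi> \<or> \<pi>' = \<pi>}"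

definition stratified :: "('v, 'p, 'c, 'f) clause set \<Rightarrow> bool" where
  "stratified P \<longleftrightarrow>
     (\<exists>r S. (\<Union>i\<in>{1..r}. S i) = prog_preds P \<and> disjoint_family_on S {1..r} \<and>
        (\<forall>(H, Ls)\<in>P. \<forall>p \<pi>. spine_head H = PConst p \<pi> \<longrightarrow>
          (\<forall>A q \<pi>'. PosLit A \<in> set Ls \<longrightarrow> spine_head A = PConst q \<pi>' \<longrightarrow>
             pred_stratum r S (q, \<pi>') \<le> pred_stratum r S (p, \<pi>)) \<and>
          (\<forall>A Q \<pi>'. PosLit A \<in> set Ls \<longrightarrow> spine_head A = Var Q (Pred \<pi>') \<longrightarrow>
             (\<forall>q\<in>preds_ge P \<pi>'. pred_stratum r S q \<le> pred_stratum r S (p, \<pi>))) \<and>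
          (\<forall>B q \<pi>'. NegLit B \<in> set Ls \<longrightarrow> spine_head B = PConst q \<pi>' \<longrightarrow>
             pred_stratum r S (q, \<pi>') < pred_stratum r S (p, \<pi>)) \<and>
          (\<forall>B Q \<pi>'. NegLit B \<in> set Ls \<longrightarrow> spine_head B = Var Q (Pred \<pi>') \<longrightarrow>
             (\<forall>q\<in>preds_ge P \<pi>'. pred_stratum r S q < pred_stratum r S (p, \<pi>)))))"

end

theory Submission
  imports Defs
begin

text \<open>Assign to a ground atom the stratum of the predicate constant at its head; finitely many
  strata embed into \<open>\<omega>\<close>. The only interesting literals are those headed by a predicate variable
  of type \<open>\<pi>\<close>: a ground instance replaces the variable by a ground term of type \<open>\<pi>\<close>, whose head
  is a predicate constant of type greater than or equal to \<open>\<pi>\<close>, so the conditions on predicate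
  variables bound the stratum of the instance.\<close>

text \<open>Each application removed from the spine restores the argument type it consumed. The
  argument removed first is the last of the spine, so its type goes at the end of the list.\<close>

lemma has_type_spine_head:
  assumes "has_type t (Pred \<pi>)"
  shows "\<exists>\<rho>s. has_type (spine_head t) (Pred (foldr Arr \<rho>s \<pi>))"
  using assms
proof (induction t arbitrary: \<pi>)
  case (App s t)
  from App.prems obtain \<rho> where "has_type s (Pred (Arr \<rho> \<pi>))"
    by (auto elim: has_type.cases)
  from App.IH(1)[OF this] obtain \<rho>s where
    "has_type (spine_head s) (Pred (foldr Arr \<rho>s (Arr \<rho> \<pi>)))" by blast
  then have "has_type (spine_head (App s t)) (Pred (foldr Arr (\<rho>s @ [\<rho>]) \<pi>))" by simp
  then show ?case by blast
qed (auto intro: exI[of _ "[]"])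

lemma spine_head_not_App: "spine_head t \<noteq> App u v"
  by (induction t) auto

lemma tm_vars_spine_head: "tm_vars (spine_head t) \<subseteq> tm_vars t"
  by (induction t) auto

lemma tm_preds_spine_head: "tm_preds (spine_head t) \<subseteq> tm_preds t"
  by (induction t) auto

text \<open>A variable at the head may be replaced by an application, which lengthens the spine;
  hence the outer \<open>spine_head\<close> on the right-hand side.\<close>

lemma spine_head_tm_subst: "spine_head (tm_subst \<theta> t) = spine_head (tm_subst \<theta> (spine_head t))"
  by (induction t) auto

text \<open>A spine head is never an application, and the typing rules for \<open>IConst\<close> and
  \<open>FunApp\<close> yield only \<open>Iota\<close>.\<close>

lemma pred_term_spine_head_cases:
  assumes "has_type t (Pred \<pi>)"
  obtains (var) Q \<rho>s where "spine_head t = Var Q (Pred (foldr Arr \<rho>s \<pi>))"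
  | (const) p \<rho>s where "spine_head t = PConst p (foldr Arr \<rho>s \<pi>)"
proof -
  from has_type_spine_head[OF assms] obtain \<rho>s where
    "has_type (spine_head t) (Pred (foldr Arr \<rho>s \<pi>))" by blast
  then show thesis
    by (cases rule: has_type.cases) (auto simp: spine_head_not_App intro: that)
qed

lemma herbrand_spine_head:
  assumes "t \<in> herbrand P (Pred \<pi>)"
  obtains q \<pi>' where "spine_head t = PConst q \<pi>'" "(q, \<pi>') \<in> preds_ge P \<pi>"
proof -
  from assms have ty: "has_type t (Pred \<pi>)" and ground: "tm_vars t = {}"
    and preds: "tm_preds t \<subseteq> prog_preds P"
    by (auto simp: herbrand_def)
  from ty show thesis
  proof (cases rule: pred_term_spine_head_cases)
    case (var Q \<rho>s)
    with ground tm_vars_spine_head[of t] show thesis by simp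
  next
    case (const q \<rho>s)
    with preds tm_preds_spine_head[of t] have "(q, foldr Arr \<rho>s \<pi>) \<in> prog_preds P" by auto
    then have "(q, foldr Arr \<rho>s \<pi>) \<in> preds_ge P \<pi>"
      \<comment> \<open>An empty list gives the equality disjunct of \<open>preds_ge\<close>, a
        nonempty one gives \<open>predty_greater\<close>.\<close>
      by (cases "\<rho>s = []") (auto simp: preds_ge_def predty_greater_def)
    with const show thesis by (rule that)
  qed
qed

lemma has_type_tm_subst:
  assumes "has_type t \<rho>" and "\<forall>(x, \<rho>')\<in>tm_vars t. has_type (\<theta> (x, \<rho>')) \<rho>'"
  shows "has_type (tm_subst \<theta> t) \<rho>"
  using assms by (induction rule: has_type.induct) (auto intro!: has_type.intros intro: has_type.intros(5))

lemma tm_subst_in_herbrand: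
  assumes "has_type t \<rho>" and "tm_preds t \<subseteq> prog_preds P"
    and "tm_iconsts t \<subseteq> prog_iconsts P" and "tm_funs t \<subseteq> prog_funs P"
    and \<theta>: "\<forall>(x, \<rho>')\<in>tm_vars t. \<theta> (x, \<rho>') \<in> herbrand P \<rho>'"
  shows "tm_subst \<theta> t \<in> herbrand P \<rho>"
proof -
  \<comment> \<open>These closure properties do not depend on typing, so structural induction on the
    term suffices; the type is treated separately by rule induction.\<close>
  have "tm_vars (tm_subst \<theta> t) = {} \<and> tm_preds (tm_subst \<theta> t) \<subseteq> prog_preds P \<and>
      tm_iconsts (tm_subst \<theta> t) \<subseteq> prog_iconsts P \<and> tm_funs (tm_subst \<theta> t) \<subseteq> prog_funs P"
    using assms(2-5)
  proof (induction t)
    case (FunApp f n ts)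
    have "tm_vars (tm_subst \<theta> t) = {} \<and> tm_preds (tm_subst \<theta> t) \<subseteq> prog_preds P \<and>
      tm_iconsts (tm_subst \<theta> t) \<subseteq> prog_iconsts P \<and> tm_funs (tm_subst \<theta> t) \<subseteq> prog_funs P"
      if "t \<in> set ts" for t
      using FunApp.prems that by (intro FunApp.IH) auto
    then show ?case using FunApp.prems by (simp add: UN_subset_iff)
  qed (auto simp: herbrand_def)
  moreover have "has_type (tm_subst \<theta> t) \<rho>"
    using assms(1) \<theta> by (intro has_type_tm_subst) (auto simp: herbrand_def)
  ultimately show ?thesis by (simp add: herbrand_def)
qed

lemma clause_tm_subst_in_herbrand:
  assumes "C \<in> P" and "t \<in> clause_tms C" and "has_type t \<rho>"
    and "\<forall>(x, \<rho>')\<in>clause_vars C. \<theta> (x, \<rho>') \<in> herbrand P \<rho>'"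
  shows "tm_subst \<theta> t \<in> herbrand P \<rho>"
  using assms
  by (intro tm_subst_in_herbrand)
    (fastforce simp: prog_preds_def prog_iconsts_def prog_funs_def clause_vars_def)+

text \<open>The two cases mirror the conditions of \<open>stratified\<close> on literals headed by a
  constant and by a variable. In the second, \<open>q\<close> is the head of the ground term
  substituted for \<open>Q\<close>.\<close>

lemma atom_subst_head_cases:
  assumes "C \<in> P" and "t \<in> clause_tms C" and "is_atom t"
    and "\<forall>(x, \<rho>')\<in>clause_vars C. \<theta> (x, \<rho>') \<in> herbrand P \<rho>'"
  obtains (const) q \<pi> where "spine_head t = PConst q \<pi>"
      "spine_head (tm_subst \<theta> t) = PConst q \<pi>"
  | (var) Q \<pi> q \<pi>' where "spine_head t = Var Q (Pred \<pi>)" "(q, \<pi>') \<in> preds_ge P \<pi>"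
      "spine_head (tm_subst \<theta> t) = PConst q \<pi>'"
proof -
  from assms(3) have "has_type t (Pred Omicron)" by (simp add: is_atom_def)
  then show thesis
  proof (cases rule: pred_term_spine_head_cases)
    case (var Q \<rho>s)
    let ?\<pi> = "foldr Arr \<rho>s Omicron"
    from var tm_vars_spine_head[of t] assms(2) have "(Q, Pred ?\<pi>) \<in> clause_vars C"
      by (auto simp: clause_vars_def)
    with assms(4) have "\<theta> (Q, Pred ?\<pi>) \<in> herbrand P (Pred ?\<pi>)" by blast
    then obtain q \<pi>' where "spine_head (\<theta> (Q, Pred ?\<pi>)) = PConst q \<pi>'"
      "(q, \<pi>') \<in> preds_ge P ?\<pi>" by (rule herbrand_spine_head)
    with var that(2) show thesis by (simp add: spine_head_tm_subst[of \<theta> t])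
  next
    case (const q \<rho>s)
    with that(1) show thesis by (simp add: spine_head_tm_subst[of \<theta> t])
  qed
qed

lemma spine_head_foldl_App: "spine_head (foldl App t ts) = spine_head t"
  by (induction ts arbitrary: t) auto

text \<open>This discharges the equality literals, whose stratum is the least element of the
  order.\<close>

lemma zero_stratum_natLeq: "(zero_stratum natLeq, n) \<in> natLeq"
proof -
  have "wo_rel natLeq" by (simp add: wo_rel_def natLeq_Well_order)
  from wo_rel.minim_least[OF this, of "Field natLeq" n] show ?thesis
    by (simp add: zero_stratum_def Field_natLeq)
qed

theorem theorem7p6:
  fixes P :: "('v, 'p, 'c, 'f) clause set"
  assumes "is_program P"
    and "stratified P"
  shows "locally_stratified P"
proof -
  from assms(2) obtain r S where strat:
    "\<forall>(H, Ls)\<in>P. \<forall>p \<pi>. spine_head H = PConst p \<pi> \<longrightarrow>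
          (\<forall>A q \<pi>'. PosLit A \<in> set Ls \<longrightarrow> spine_head A = PConst q \<pi>' \<longrightarrow>
             pred_stratum r S (q, \<pi>') \<le> pred_stratum r S (p, \<pi>)) \<and>
          (\<forall>A Q \<pi>'. PosLit A \<in> set Ls \<longrightarrow> spine_head A = Var Q (Pred \<pi>') \<longrightarrow>
             (\<forall>q\<in>preds_ge P \<pi>'. pred_stratum r S q \<le> pred_stratum r S (p, \<pi>))) \<and>
          (\<forall>B q \<pi>'. NegLit B \<in> set Ls \<longrightarrow> spine_head B = PConst q \<pi>' \<longrightarrow>
             pred_stratum r S (q, \<pi>') < pred_stratum r S (p, \<pi>)) \<and>
          (\<forall>B Q \<pi>'. NegLit B \<in> set Ls \<longrightarrow> spine_head B = Var Q (Pred \<pi>') \<longrightarrow>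
             (\<forall>q\<in>preds_ge P \<pi>'. pred_stratum r S q < pred_stratum r S (p, \<pi>)))"
    unfolding stratified_def by (elim exE conjE) (rule that)
  \<comment> \<open>Ground atoms are headed by predicate constants, so on
    \<open>herbrand P (Pred Omicron)\<close> the first branch applies.\<close>
  define lev :: "('v, 'p, 'c, 'f) tm \<Rightarrow> nat" where
    "lev A = (case spine_head A of PConst p \<pi> \<Rightarrow> pred_stratum r S (p, \<pi>) | _ \<Rightarrow> 0)" for A
  \<comment> \<open>Level sets of a function are disjoint and cover its domain.
    \<open>locally_stratified\<close> admits empty strata, so all of \<open>natLeq\<close> can serve
    as the index order.\<close>
  define T where "T n = {A \<in> herbrand P (Pred Omicron). lev A = n}" for n
  have stratum: "atom_stratum natLeq T A = lev A" if "A \<in> herbrand P (Pred Omicron)" for A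
    using that unfolding atom_stratum_def T_def by (auto simp: Field_natLeq)
  have "literal_locally_ok natLeq T H L" if "(H, Ls) \<in> Gr P" and "L \<in> set Ls" for H Ls L
  proof -
    from that(1) obtain \<theta> H' Ls' where C: "(H', Ls') \<in> P"
      and \<theta>: "\<forall>(x, \<rho>)\<in>clause_vars (H', Ls'). \<theta> (x, \<rho>) \<in> herbrand P \<rho>"
      and H: "H = tm_subst \<theta> H'" and Ls: "Ls = map (literal_subst \<theta>) Ls'"
      by (auto simp: Gr_def clause_subst_def)
    from that(2) Ls obtain L' where L': "L' \<in> set Ls'" and L: "L = literal_subst \<theta> L'" by auto
    from assms(1) C have cl: "is_clause (H', Ls')" by (auto simp: is_program_def)
    then have atomH: "is_atom H'" and wf: "wf_literal L'"
      using L' by (auto simp: is_clause_def is_head_def)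
    from cl obtain p \<pi> where hd: "spine_head H' = PConst p \<pi>"
      by (auto simp: is_clause_def is_head_def spine_head_foldl_App)
    have ground: "atom_stratum natLeq T (tm_subst \<theta> A) = lev (tm_subst \<theta> A)"
      if "A \<in> clause_tms (H', Ls')" "is_atom A" for A
      using clause_tm_subst_in_herbrand[OF C that(1) _ \<theta>] that(2)
      by (intro stratum) (simp add: is_atom_def)
    \<comment> \<open>The head of a clause starts with a constant, which substitution preserves; all
      instances of the clause thus have their heads in one stratum.\<close>
    have "lev H = pred_stratum r S (p, \<pi>)"
      using hd by (simp add: lev_def H spine_head_tm_subst[of \<theta> H'])
    with ground[of H'] atomH have levH: "atom_stratum natLeq T H = pred_stratum r S (p, \<pi>)"
      by (simp add: H clause_tms_def)
    note strat_clause = strat[rule_format, OF C, simplified, rule_format, OF hd]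
    show ?thesis
    proof (cases L')
      case (PosLit A)
      with L' wf have A: "A \<in> clause_tms (H', Ls')" "is_atom A" and mem: "PosLit A \<in> set Ls'"
        by (force simp: clause_tms_def)+
      from C A \<theta> have "lev (tm_subst \<theta> A) \<le> pred_stratum r S (p, \<pi>)"
        by (cases rule: atom_subst_head_cases) (use strat_clause mem in \<open>auto simp: lev_def\<close>)
      with ground[OF A] levH show ?thesis by (simp add: L PosLit natLeq_def)
    next
      case (EqLit s t)
      then show ?thesis by (simp add: L zero_stratum_natLeq)
    next
      case (NegLit B)
      with L' wf have B: "B \<in> clause_tms (H', Ls')" "is_atom B" and mem: "NegLit B \<in> set Ls'"
        by (force simp: clause_tms_def)+
      \<comment> \<open>Conditions (3) and (4) make the inequality strict for both kinds of head,
        which gives membership in \<open>natLeq - Id\<close>.\<close>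
      from C B \<theta> have "lev (tm_subst \<theta> B) < pred_stratum r S (p, \<pi>)"
        by (cases rule: atom_subst_head_cases) (use strat_clause mem in \<open>auto simp: lev_def\<close>)
      with ground[OF B] levH show ?thesis by (simp add: L NegLit natLeq_def)
    qed
  qed
  moreover have "(\<Union>n\<in>Field natLeq. T n) = herbrand P (Pred Omicron)"
    by (auto simp: T_def Field_natLeq)
  moreover have "disjoint_family_on T (Field natLeq)"
    by (auto simp: disjoint_family_on_def T_def)
  ultimately show ?thesis
    unfolding locally_stratified_def using natLeq_Well_order by blast
qed

end
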